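(* Assume that for every $\mathcal{T}\in\mathbb{T}$ the LICQ holds at every $\mathbf{z}\in\mathcal{Z}_{\mathcal{T}}$ with respect to the fixed constraints of the auxiliary model $\mathbf{P}_{R\_E}(\mathbf{d},\mathcal{T})$, i.e. the gradients at $\mathbf{z}$ of all fixed equality constraints and of all fixed inequality constraints active at $\mathbf{z}$ are linearly independent. Then, almost surely, i.e. for almost every load $\mathbf{d}\in\mathcal{D}$ (Lebesgue measure), at every locally optimal solution $(\mathbf{z}^*,\mathbf{u}^* )$ of the DNR model with load $\mathbf{d}$ there exist Lagrange multipliers such that the KKT conditions of the DNR model are satisfied.
   Context: Network: a power distribution network with finite set of buses $\mathcal{N}$ and finite set of lines $\mathcal{L}$; each line $ij\in\mathcal{L}$ joins buses $i,j$ and has a presupposed direction from $i$ to $j$. $\mathcal{L}_j^+$ is the set of lines $ij$ directed into bus $j$, and $\mathcal{L}_j^-$ is the set of lines $jk$ directed out of bus $j$. Real parameters: resistances $r_{ij}$, reactances $x_{ij}$, limits $P_{ij}^{\max},Q_{ij}^{\max}$ for $ij\in\mathcal{L}$, voltage limits $V_i^{\min},V_i^{\max}$ for $i\in\mathcal{N}$, and a large constant $M$. The load vector is $\mathbf{d}=(d_j^P,d_j^Q)_{j\in\mathcal{N}}\in\mathcal{D}$, where $\mathcal{D}\subseteq\mathbb{R}^{2|\mathcal{N}|}$ is a nonempty open set (of nonzero measure). $\mathbb{T}$ is the set of all connected radial sub-networks, i.e. spanning trees $\mathcal{T}$ of the network, with vertex set $\mathcal{N}$ and edge set $\mathcal{L}(\mathcal{T})\subseteq\mathcal{L}$.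 Common variable: $\mathbf{z}\in\mathbb{R}^{3|\mathcal{N}|+3|\mathcal{L}|}$ has real components $g_j^P,g_j^Q,v_j$ ($j\in\mathcal{N}$) and $p_{ij},q_{ij},l_{ij}$ ($ij\in\mathcal{L}$); the net injections are $p_j=g_j^P-d_j^P$, $q_j=g_j^Q-d_j^Q$. DNR model with load $\mathbf{d}$: the variables are $\mathbf{z}$ and $\mathbf{u}=(u_{ij})_{ij\in\mathcal{L}}\in\mathbb{R}^{|\mathcal{L}|}$. Minimize $\sum_{ij\in\mathcal{L}}r_{ij}l_{ij}$ subject to (1b) $g_j^P-d_j^P=\sum_{ij\in\mathcal{L}_j^+}(r_{ij}l_{ij}-p_{ij})+\sum_{jk\in\mathcal{L}_j^-}p_{jk}$, $\forall j\in\mathcal{N}$; (1c) $g_j^Q-d_j^Q=\sum_{ij\in\mathcal{L}_j^+}(x_{ij}l_{ij}-q_{ij})+\sum_{jk\in\mathcal{L}_j^-}q_{jk}$, $\forall j\in\mathcal{N}$; (1d) $v_i-v_j\ge 2(r_{ij}p_{ij}+x_{ij}q_{ij})-(r_{ij}^2+x_{ij}^2)l_{ij}-M(1-u_{ij})$, $\forall ij\in\mathcal{L}$; (1e) $v_i-v_j\le 2(r_{ij}p_{ij}+x_{ij}q_{ij})-(r_{ij}^2+x_{ij}^2)l_{ij}+M(1-u_{ij})$, $\forall ij\in\mathcal{L}$; (1f) $v_il_{ij}=p_{ij}^2+q_{ij}^2$, $\forall ij\in\mathcal{L}$; (1g) $-u_{ij}P_{ij}^{\max}\le p_{ij}\le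 u_{ij}P_{ij}^{\max}$, $\forall ij\in\mathcal{L}$; (1h) $-u_{ij}Q_{ij}^{\max}\le q_{ij}\le u_{ij}Q_{ij}^{\max}$, $\forall ij\in\mathcal{L}$; (1i) $(V_i^{\min})^2\le v_i\le(V_i^{\max})^2$, $\forall i\in\mathcal{N}$; (1j) $u_{ij}(u_{ij}-1)=0$, $\forall ij\in\mathcal{L}$; (1k) $\sum_{ij\in\mathcal{L}_j^+}u_{ij}+\sum_{jk\in\mathcal{L}_j^-}u_{jk}\ge1$, $\forall j\in\mathcal{N}$; (1l) $\sum_{j\in\mathcal{N}}\sum_{ij\in\mathcal{L}_j^+}u_{ij}=|\mathcal{N}|-1$. Standing assumptions on the DNR model: (i) $M$ is so large that constraints (1d), (1e) are invalidated for switched-off lines, i.e. they impose no restriction (hold with strict inequality) when $u_{ij}=0$; (ii) constraints (1j)-(1l) ensure a fully connected radial structure: for every feasible solution, the set $\{ij\in\mathcal{L}:u_{ij}=1\}$ of switched-on lines is the edge set $\mathcal{L}(\mathcal{T})$ of some $\mathcal{T}\in\mathbb{T}$. KKT conditions of the DNR model: write $\mathbf{y}=(\mathbf{z},\mathbf{u})$, objective $f(\mathbf{y})$, all equality constraints as $\mathbf{g}(\mathbf{y})=\mathbf{0}$ (that is (1b), (1c), (1f), (1j), (1l)) and all inequality constraints as $\mathbf{h}(\mathbf{y})\le\mathbf{0}$ (that is (1d), (1e), (1g)-(1i), (1k), two-sided bounds counting as two scalar inequalities). Lagrange multipliers $\boldsymbol{\lambda}^*,\boldsymbol{\mu}^*$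 satisfy the KKT conditions at $\mathbf{y}^*$ if $-\nabla f(\mathbf{y}^* )^T=(\boldsymbol{\lambda}^* )^T\nabla\mathbf{g}(\mathbf{y}^* )+(\boldsymbol{\mu}^* )^T\nabla\mathbf{h}(\mathbf{y}^* )$, $\mathbf{g}(\mathbf{y}^* )=\mathbf{0}$, $\mathbf{h}(\mathbf{y}^* )\le\mathbf{0}$, $\boldsymbol{\mu}^*\ge\mathbf{0}$, $(\boldsymbol{\mu}^* )^T\mathbf{h}(\mathbf{y}^* )=0$, where $\nabla\mathbf{g},\nabla\mathbf{h}$ denote Jacobians. Auxiliary model $\mathbf{P}_{R\_E}(\mathbf{d},\mathcal{T})$: the variable is $\mathbf{z}$. Minimize a continuously differentiable function $w(\mathbf{z})$ subject to (1b), (1c) above (the variable constraints, which contain $\mathbf{d}$) and the following fixed constraints (which do not contain $\mathbf{d}$): - $v_i-v_j=2(r_{ij}p_{ij}+x_{ij}q_{ij})-(r_{ij}^2+x_{ij}^2)l_{ij}$, $\forall ij\in\mathcal{L}(\mathcal{T})$; - $v_il_{ij}=p_{ij}^2+q_{ij}^2$, $\forall ij\in\mathcal{L}$; - $p_{ij}=0$ and $q_{ij}=0$, $\forall ij\in\mathcal{L}\setminus\mathcal{L}(\mathcal{T})$; - $-P_{ij}^{\max}\le p_{ij}\le P_{ij}^{\max}$ and $-Q_{ij}^{\max}\le q_{ij}\le Q_{ij}^{\max}$, $\forall ij\in\mathcal{L}(\mathcal{T})$; - $(V_i^{\min})^2\le v_i\le(V_i^{\max})^2$, $\forall i\in\mathcal{N}$.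 $\mathcal{Z}_{\mathcal{T}}$ is the set of all $\mathbf{z}\in\mathbb{R}^{3|\mathcal{N}|+3|\mathcal{L}|}$ satisfying all the fixed constraints for $\mathcal{T}$. A locally optimal solution is a feasible point that minimizes the objective among all feasible points in some neighbourhood of it. *)

theory Defs
  imports "HOL-Analysis.Analysis"
begin

section \<open>Nonlinear programs with finitely many constraints\<close>

text \<open>
  A program is given by an objective \<open>f\<close>, equality constraints \<open>g i y = 0\<close> for \<open>i \<in> I\<close> and
  inequality constraints \<open>h j y \<le> 0\<close> for \<open>j \<in> J\<close>.
\<close>

definition feasible_set ::
  "'i set \<Rightarrow> ('i \<Rightarrow> 'a \<Rightarrow> real) \<Rightarrow> 'j set \<Rightarrow> ('j \<Rightarrow> 'a \<Rightarrow> real) \<Rightarrow> 'a set" where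
  "feasible_set I g J h = {y. (\<forall>i\<in>I. g i y = 0) \<and> (\<forall>j\<in>J. h j y \<le> 0)}"

definition locally_optimal :: "('a::topological_space \<Rightarrow> real) \<Rightarrow> 'a set \<Rightarrow> 'a \<Rightarrow> bool" where
  "locally_optimal f S y \<longleftrightarrow>
     y \<in> S \<and> (\<exists>U. open U \<and> y \<in> U \<and> (\<forall>y'\<in>U \<inter> S. f y \<le> f y'))"

text \<open>The gradient is unspecified at points where \<open>f\<close> is not differentiable.\<close>

definition gradient :: "('a::euclidean_space \<Rightarrow> real) \<Rightarrow> 'a \<Rightarrow> 'a" where
  "gradient f y = (THE D. GDERIV f y :> D)"

text \<open>
  Linear independence is that of the family of gradients, not merely of the set of their values:
  two constraints with equal gradients violate LICQ, hence \<^const>\<open>inj_on\<close>.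
\<close>

definition licq ::
  "'i set \<Rightarrow> ('i \<Rightarrow> 'a::euclidean_space \<Rightarrow> real) \<Rightarrow> 'j set \<Rightarrow> ('j \<Rightarrow> 'a \<Rightarrow> real) \<Rightarrow> 'a \<Rightarrow> bool" where
  "licq I g J h y \<longleftrightarrow>
     (let A = I <+> {j \<in> J. h j y = 0};
          G = case_sum (\<lambda>i. gradient (g i) y) (\<lambda>j. gradient (h j) y)
      in inj_on G A \<and> independent (G ` A))"

definition kkt ::
  "('a::euclidean_space \<Rightarrow> real) \<Rightarrow> 'i set \<Rightarrow> ('i \<Rightarrow> 'a \<Rightarrow> real) \<Rightarrow> 'j set \<Rightarrow> ('j \<Rightarrow> 'a \<Rightarrow> real) \<Rightarrow>
   'a \<Rightarrow> ('i \<Rightarrow> real) \<Rightarrow> ('j \<Rightarrow> real) \<Rightarrow> bool" where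
  "kkt f I g J h y lam mu \<longleftrightarrow>
     - gradient f y =
       (\<Sum>i\<in>I. lam i *\<^sub>R gradient (g i) y) + (\<Sum>j\<in>J. mu j *\<^sub>R gradient (h j) y) \<and>
     (\<forall>i\<in>I. g i y = 0) \<and> (\<forall>j\<in>J. h j y \<le> 0) \<and>
     (\<forall>j\<in>J. 0 \<le> mu j) \<and> (\<Sum>j\<in>J. mu j * h j y) = 0"


section \<open>Networks and spanning trees\<close>

text \<open>
  The set of buses is the finite type \<open>'n\<close> and the set of lines the finite type \<open>'l\<close>; the line
  \<open>e\<close> is directed from \<open>src N e\<close> to \<open>tgt N e\<close>.
\<close>

record ('n, 'l) network =
  src :: "'l \<Rightarrow> 'n"
  tgt :: "'l \<Rightarrow> 'n"
  res :: "'l \<Rightarrow> real"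
  rea :: "'l \<Rightarrow> real"
  Pmax :: "'l \<Rightarrow> real"
  Qmax :: "'l \<Rightarrow> real"
  Vmin :: "'n \<Rightarrow> real"
  Vmax :: "'n \<Rightarrow> real"
  bigM :: real

definition lines_in :: "('n, 'l) network \<Rightarrow> 'n \<Rightarrow> 'l set" where
  "lines_in N j = {e. tgt N e = j}"

definition lines_out :: "('n, 'l) network \<Rightarrow> 'n \<Rightarrow> 'l set" where
  "lines_out N j = {e. src N e = j}"

text \<open>Walks may use lines against their direction.\<close>

definition joins :: "('n, 'l) network \<Rightarrow> 'l \<Rightarrow> 'n \<Rightarrow> 'n \<Rightarrow> bool" where
  "joins N e i j \<longleftrightarrow> (src N e = i \<and> tgt N e = j) \<or> (src N e = j \<and> tgt N e = i)"

primrec walk :: "('n, 'l) network \<Rightarrow> 'l set \<Rightarrow> 'n \<Rightarrow> 'l list \<Rightarrow> 'n \<Rightarrow> bool" where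
  "walk N T i [] j \<longleftrightarrow> i = j"
| "walk N T i (e # es) j \<longleftrightarrow> e \<in> T \<and> (\<exists>k. joins N e i k \<and> walk N T k es j)"

definition connected_lines :: "('n, 'l) network \<Rightarrow> 'l set \<Rightarrow> bool" where
  "connected_lines N T \<longleftrightarrow> (\<forall>i j. \<exists>es. walk N T i es j)"

text \<open>Every nonempty closed walk without repeated lines contains a cycle, and conversely.\<close>

definition acyclic_lines :: "('n, 'l) network \<Rightarrow> 'l set \<Rightarrow> bool" where
  "acyclic_lines N T \<longleftrightarrow> \<not> (\<exists>i es. es \<noteq> [] \<and> distinct es \<and> walk N T i es i)"

text \<open>A spanning tree is represented by its set of lines; its vertices are all buses.\<close>

definition spanning_trees :: "('n, 'l) network \<Rightarrow> 'l set set" where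
  "spanning_trees N = {T. connected_lines N T \<and> acyclic_lines N T}"


section \<open>Variables and loads\<close>

text \<open>A load \<open>d\<close> is the pair of its active and its reactive components.\<close>

type_synonym 'n load = "(real^'n) \<times> (real^'n)"

text \<open>\<open>z = (gP, gQ, v, p, q, l)\<close>\<close>

type_synonym ('n, 'l) zvar =
  "(real^'n) \<times> (real^'n) \<times> (real^'n) \<times> (real^'l) \<times> (real^'l) \<times> (real^'l)"

abbreviation gP :: "('n, 'l) zvar \<Rightarrow> real^'n" where "gP z \<equiv> fst z"
abbreviation gQ :: "('n, 'l) zvar \<Rightarrow> real^'n" where "gQ z \<equiv> fst (snd z)"
abbreviation vv :: "('n, 'l) zvar \<Rightarrow> real^'n" where "vv z \<equiv> fst (snd (snd z))"
abbreviation pp :: "('n, 'l) zvar \<Rightarrow> real^'l" where "pp z \<equiv> fst (snd (snd (snd z)))"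
abbreviation qq :: "('n, 'l) zvar \<Rightarrow> real^'l" where "qq z \<equiv> fst (snd (snd (snd (snd z))))"
abbreviation ll :: "('n, 'l) zvar \<Rightarrow> real^'l" where "ll z \<equiv> snd (snd (snd (snd (snd z))))"

text \<open>\<open>y = (z, u)\<close>\<close>

type_synonym ('n, 'l) yvar = "('n, 'l) zvar \<times> (real^'l)"

text \<open>The residual of the voltage drop equation along line \<open>e\<close>.\<close>

definition drop_residual :: "('n::finite, 'l::finite) network \<Rightarrow> 'l \<Rightarrow> ('n, 'l) zvar \<Rightarrow> real" where
  "drop_residual N e z =
     vv z $ src N e - vv z $ tgt N e -
     (2 * (res N e * pp z $ e + rea N e * qq z $ e) - ((res N e)\<^sup>2 + (rea N e)\<^sup>2) * ll z $ e)"


section \<open>The DNR model\<close>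

datatype ('n, 'l) dnr_eq_idx =
  PBal 'n | QBal 'n | Flow 'l | Binary 'l | LineCount

datatype ('n, 'l) dnr_ineq_idx =
  DropLo 'l | DropUp 'l | PLo 'l | PUp 'l | QLo 'l | QUp 'l | VLo 'n | VUp 'n | Degree 'n

instance dnr_eq_idx :: (finite, finite) finite
proof
  have "(UNIV :: ('a, 'b) dnr_eq_idx set) \<subseteq>
      range PBal \<union> range QBal \<union> range Flow \<union> range Binary \<union> {LineCount}" (is "_ \<subseteq> ?R")
  proof
    fix c :: "('a, 'b) dnr_eq_idx"
    show "c \<in> ?R" by (cases c) auto
  qed
  then show "finite (UNIV :: ('a, 'b) dnr_eq_idx set)"
    by (rule finite_subset) simp
qed

instance dnr_ineq_idx :: (finite, finite) finite
proof
  have "(UNIV :: ('a, 'b) dnr_ineq_idx set) \<subseteq>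
      range DropLo \<union> range DropUp \<union> range PLo \<union> range PUp \<union> range QLo \<union> range QUp \<union>
      range VLo \<union> range VUp \<union> range Degree" (is "_ \<subseteq> ?R")
  proof
    fix c :: "('a, 'b) dnr_ineq_idx"
    show "c \<in> ?R" by (cases c) auto
  qed
  then show "finite (UNIV :: ('a, 'b) dnr_ineq_idx set)"
    by (rule finite_subset) simp
qed

primrec dnr_eq ::
  "('n::finite, 'l::finite) network \<Rightarrow> 'n load \<Rightarrow> ('n, 'l) dnr_eq_idx \<Rightarrow> ('n, 'l) yvar \<Rightarrow> real" where
  "dnr_eq N d (PBal j) = (\<lambda>(z, u).
     gP z $ j - fst d $ j -
     ((\<Sum>e\<in>lines_in N j. res N e * ll z $ e - pp z $ e) + (\<Sum>e\<in>lines_out N j. pp z $ e)))"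
| "dnr_eq N d (QBal j) = (\<lambda>(z, u).
     gQ z $ j - snd d $ j -
     ((\<Sum>e\<in>lines_in N j. rea N e * ll z $ e - qq z $ e) + (\<Sum>e\<in>lines_out N j. qq z $ e)))"
| "dnr_eq N d (Flow e) = (\<lambda>(z, u).
     vv z $ src N e * ll z $ e - ((pp z $ e)\<^sup>2 + (qq z $ e)\<^sup>2))"
| "dnr_eq N d (Binary e) = (\<lambda>(z, u). u $ e * (u $ e - 1))"
| "dnr_eq N d LineCount = (\<lambda>(z, u).
     (\<Sum>j\<in>UNIV. \<Sum>e\<in>lines_in N j. u $ e) - (real CARD('n) - 1))"

primrec dnr_ineq ::
  "('n::finite, 'l::finite) network \<Rightarrow> ('n, 'l) dnr_ineq_idx \<Rightarrow> ('n, 'l) yvar \<Rightarrow> real" where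
  "dnr_ineq N (DropLo e) = (\<lambda>(z, u). - drop_residual N e z - bigM N * (1 - u $ e))"
| "dnr_ineq N (DropUp e) = (\<lambda>(z, u). drop_residual N e z - bigM N * (1 - u $ e))"
| "dnr_ineq N (PLo e) = (\<lambda>(z, u). - (u $ e * Pmax N e) - pp z $ e)"
| "dnr_ineq N (PUp e) = (\<lambda>(z, u). pp z $ e - u $ e * Pmax N e)"
| "dnr_ineq N (QLo e) = (\<lambda>(z, u). - (u $ e * Qmax N e) - qq z $ e)"
| "dnr_ineq N (QUp e) = (\<lambda>(z, u). qq z $ e - u $ e * Qmax N e)"
| "dnr_ineq N (VLo i) = (\<lambda>(z, u). (Vmin N i)\<^sup>2 - vv z $ i)"
| "dnr_ineq N (VUp i) = (\<lambda>(z, u). vv z $ i - (Vmax N i)\<^sup>2)"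
| "dnr_ineq N (Degree j) = (\<lambda>(z, u).
     1 - ((\<Sum>e\<in>lines_in N j. u $ e) + (\<Sum>e\<in>lines_out N j. u $ e)))"

definition dnr_obj :: "('n::finite, 'l::finite) network \<Rightarrow> ('n, 'l) yvar \<Rightarrow> real" where
  "dnr_obj N = (\<lambda>(z, u). \<Sum>e\<in>UNIV. res N e * ll z $ e)"

definition dnr_feasible ::
  "('n::finite, 'l::finite) network \<Rightarrow> 'n load \<Rightarrow> ('n, 'l) yvar set" where
  "dnr_feasible N d = feasible_set UNIV (dnr_eq N d) UNIV (dnr_ineq N)"

text \<open>
  The constant \<open>M\<close> is large enough for the loads in \<open>D\<close>: at every point that satisfies all
  constraints except possibly the two voltage drop inequalities of the switched-off lines, these
  inequalities hold strictly.
\<close>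

definition bigM_sufficient ::
  "('n::finite, 'l::finite) network \<Rightarrow> 'n load set \<Rightarrow> bool" where
  "bigM_sufficient N D \<longleftrightarrow>
     (\<forall>d\<in>D. \<forall>z u.
        let off = {e. u $ e = 0} in
        (z, u) \<in> feasible_set UNIV (dnr_eq N d) (- (DropLo ` off \<union> DropUp ` off)) (dnr_ineq N) \<longrightarrow>
        (\<forall>e\<in>off. dnr_ineq N (DropLo e) (z, u) < 0 \<and> dnr_ineq N (DropUp e) (z, u) < 0))"

definition radiality_ensured ::
  "('n::finite, 'l::finite) network \<Rightarrow> 'n load set \<Rightarrow> bool" where
  "radiality_ensured N D \<longleftrightarrow>
     (\<forall>d\<in>D. \<forall>(z, u)\<in>dnr_feasible N d. {e. u $ e = 1} \<in> spanning_trees N)"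


section \<open>The fixed constraints of the auxiliary model for a tree \<open>T\<close>\<close>

datatype 'l fix_eq_idx = FDrop 'l | FFlow 'l | FPOff 'l | FQOff 'l

datatype ('n, 'l) fix_ineq_idx =
  FPLo 'l | FPUp 'l | FQLo 'l | FQUp 'l | FVLo 'n | FVUp 'n

primrec fix_eq ::
  "('n::finite, 'l::finite) network \<Rightarrow> 'l fix_eq_idx \<Rightarrow> ('n, 'l) zvar \<Rightarrow> real" where
  "fix_eq N (FDrop e) = (\<lambda>z. drop_residual N e z)"
| "fix_eq N (FFlow e) = (\<lambda>z. vv z $ src N e * ll z $ e - ((pp z $ e)\<^sup>2 + (qq z $ e)\<^sup>2))"
| "fix_eq N (FPOff e) = (\<lambda>z. pp z $ e)"
| "fix_eq N (FQOff e) = (\<lambda>z. qq z $ e)"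

primrec fix_ineq ::
  "('n::finite, 'l::finite) network \<Rightarrow> ('n, 'l) fix_ineq_idx \<Rightarrow> ('n, 'l) zvar \<Rightarrow> real" where
  "fix_ineq N (FPLo e) = (\<lambda>z. - Pmax N e - pp z $ e)"
| "fix_ineq N (FPUp e) = (\<lambda>z. pp z $ e - Pmax N e)"
| "fix_ineq N (FQLo e) = (\<lambda>z. - Qmax N e - qq z $ e)"
| "fix_ineq N (FQUp e) = (\<lambda>z. qq z $ e - Qmax N e)"
| "fix_ineq N (FVLo i) = (\<lambda>z. (Vmin N i)\<^sup>2 - vv z $ i)"
| "fix_ineq N (FVUp i) = (\<lambda>z. vv z $ i - (Vmax N i)\<^sup>2)"

definition fix_eqs :: "'l set \<Rightarrow> 'l fix_eq_idx set" where
  "fix_eqs T = FDrop ` T \<union> range FFlow \<union> FPOff ` (- T) \<union> FQOff ` (- T)"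

definition fix_ineqs :: "'l set \<Rightarrow> ('n, 'l) fix_ineq_idx set" where
  "fix_ineqs T = FPLo ` T \<union> FPUp ` T \<union> FQLo ` T \<union> FQUp ` T \<union> range FVLo \<union> range FVUp"

definition Z_set :: "('n::finite, 'l::finite) network \<Rightarrow> 'l set \<Rightarrow> ('n, 'l) zvar set" where
  "Z_set N T = feasible_set (fix_eqs T) (fix_eq N) (fix_ineqs T) (fix_ineq N)"

end

theory Submission
  imports Defs
begin

text \<open>
  The idea is that the balance equations do not constrain anything: the generations \<open>gP\<close> and \<open>gQ\<close>
  occur in no limit, in no fixed constraint and not in the objective, so each balance equation merely
  computes one generation value from the load and the other variables. This is why the conclusion is
  reached for each individual load in \<open>D\<close>, by a deterministic argument.

  Let \<open>(z, u)\<close> be locally optimal and let \<open>T\<close> be its set of switched-on lines, a spanning tree by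
  radiality. Points near \<open>z\<close> that satisfy the fixed constraints for \<open>T\<close> become DNR feasible with the
  same \<open>u\<close> once their generation is balanced; the relaxed voltage drops of switched-off lines
  survive because \<open>M\<close> makes them strict. Hence \<open>z\<close> locally minimizes the line loss subject to the
  fixed constraints alone (\<open>dnr_locally_optimal_imp_line_loss_locally_optimal\<close>). The assumed LICQ is
  exactly the constraint qualification of this smaller program, so it has Lagrange multipliers at \<open>z\<close>
  (\<open>locally_optimal_licq_imp_kkt\<close>, the first-order necessary condition for general programs).

  These multipliers extend to the DNR model (\<open>dnr_kkt_if_fixed_kkt\<close>): equations that the DNR
  model expresses by pairs of inequalities share out their multiplier by sign, the balance equations
  get multiplier zero, and whatever the switching variables contribute to the gradient condition is
  cancelled by the constraints \<open>u (u - 1) = 0\<close>, whose gradient is nonzero at binary \<open>u\<close>.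
\<close>

section \<open>Gradients\<close>

lemma GDERIV_imp_gradient_eq:
  assumes "GDERIV f y :> D"
  shows "gradient f y = D"
  unfolding gradient_def
proof (rule the_equality)
  show "GDERIV f y :> D" by (fact assms)
next
  fix D' assume "GDERIV f y :> D'"
  with assms have "(\<lambda>h. inner h D') = (\<lambda>h. inner h D)"
    unfolding gderiv_def by (rule has_derivative_unique[rotated])
  then have "inner h (D' - D) = 0" for h
    by (simp add: inner_diff_right fun_eq_iff)
  from this[of "D' - D"] show "D' = D"
    by simp
qed

lemma differentiable_imp_GDERIV_gradient:
  assumes "f differentiable at y"
  shows "GDERIV f y :> gradient f y"
proof -
  obtain f' where f': "(f has_derivative f') (at y)"
    using assms unfolding differentiable_def by blast
  then have "f' = (\<lambda>h. inner h (adjoint f' 1))"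
    by (simp add: fun_eq_iff adjoint_works has_derivative_linear)
  with f' have "GDERIV f y :> adjoint f' 1"
    unfolding gderiv_def by simp
  then show ?thesis
    by (simp only: GDERIV_imp_gradient_eq)
qed

lemma gradient_sum_of_separate_variables:
  assumes "F differentiable at z" "GDERIV G u :> D"
  shows "gradient (\<lambda>(z, u). F z + G u) (z, u) = (gradient F z, D)"
proof (rule GDERIV_imp_gradient_eq)
  have "((\<lambda>y. F (fst y)) has_derivative (\<lambda>h. inner (fst h) (gradient F z))) (at (z, u))"
    using differentiable_imp_GDERIV_gradient[OF assms(1)]
    by (intro has_derivative_compose[of fst fst _ _ F] derivative_intros) (simp_all add: gderiv_def)
  moreover have "((\<lambda>y. G (snd y)) has_derivative (\<lambda>h. inner (snd h) D)) (at (z, u))"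
    using assms(2)
    by (intro has_derivative_compose[of snd snd _ _ G] derivative_intros) (simp_all add: gderiv_def)
  ultimately have "((\<lambda>y. F (fst y) + G (snd y)) has_derivative
      (\<lambda>h. inner (fst h) (gradient F z) + inner (snd h) D)) (at (z, u))"
    by (rule has_derivative_add)
  then show "GDERIV (\<lambda>(z, u). F z + G u) (z, u) :> (gradient F z, D)"
    by (simp add: gderiv_def inner_prod_def case_prod_unfold)
qed

lemma GDERIV_vec_nth: "GDERIV (\<lambda>u. u $ e) u :> axis e (1::real)"
  unfolding gderiv_def by (simp add: inner_axis bounded_linear_imp_has_derivative bounded_linear_vec_nth)

lemma GDERIV_affine_component: "GDERIV (\<lambda>u. k + c * u $ e) u :> c *\<^sub>R axis e (1::real)"
  using GDERIV_add[OF GDERIV_const GDERIV_mult[OF GDERIV_const GDERIV_vec_nth]] by simp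

lemma gradient_minus: "F differentiable at z \<Longrightarrow> gradient (\<lambda>z. - F z) z = - gradient F z"
  by (intro GDERIV_imp_gradient_eq GDERIV_minus differentiable_imp_GDERIV_gradient)

lemma gradient_const_plus: "F differentiable at z \<Longrightarrow> gradient (\<lambda>z. c + F z) z = gradient F z"
  using GDERIV_imp_gradient_eq[OF GDERIV_add[OF GDERIV_const differentiable_imp_GDERIV_gradient]]
  by force

section \<open>The first-order condition under LICQ\<close>

text \<open>
  The dual vector of \<open>a k\<close> is the component of \<open>a k\<close> orthogonal to the other vectors, rescaled;
  independence makes this component nonzero.
\<close>

lemma dual_family_exists:
  fixes a :: "'k \<Rightarrow> 'a::euclidean_space"
  assumes "inj_on a K" "independent (a ` K)"
  obtains b where
    "\<And>k l. k \<in> K \<Longrightarrow> l \<in> K \<Longrightarrow> inner (a l) (b k) = (if l = k then 1 else 0)"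
proof -
  have "\<exists>b. \<forall>l\<in>K. inner (a l) b = (if l = k then 1 else 0)" if k: "k \<in> K" for k
  proof -
    let ?S = "a ` (K - {k})"
    obtain y z where
      yz: "y \<in> span ?S" "\<And>w. w \<in> span ?S \<Longrightarrow> orthogonal z w" "a k = y + z"
      using orthogonal_subspace_decomp_exists by blast
    have "?S = a ` K - {a k}"
      using assms(1) k by (auto simp: inj_on_def)
    then have "a k \<notin> span ?S"
      using assms(2) k unfolding dependent_def by force
    with yz(1,3) have "z \<noteq> 0" by auto
    have "inner (a k) z = inner z z"
      using yz(2)[OF yz(1)]
      by (simp add: yz(3) inner_add_left orthogonal_def inner_commute[of y])
    moreover have "inner (a l) z = 0" if "l \<in> K" "l \<noteq> k" for l
      using yz(2)[of "a l"] that by (simp add: span_base orthogonal_def inner_commute)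
    ultimately show ?thesis
      using \<open>z \<noteq> 0\<close> by (intro exI[of _ "(1 / inner z z) *\<^sub>R z"]) auto
  qed
  then have "\<forall>k\<in>K. \<exists>b. \<forall>l\<in>K. inner (a l) b = (if l = k then 1 else 0)"
    by blast
  from bchoice[OF this] show thesis
    using that by blast
qed

text \<open>
  A map with derivative the identity at its fixed point \<open>y\<close> takes the value \<open>y + t w\<close> at a point that
  differs from \<open>y + t w\<close> by at most \<open>e t\<close>, for some small \<open>t\<close>. The equation \<open>F x = c\<close> says that \<open>x\<close> is
  a fixed point of \<open>\<lambda>x. c + x - F x\<close>, and \<open>x - F x\<close> is so small near \<open>y\<close> that this map sends the ball of
  radius \<open>e t\<close> around \<open>c = y + t w\<close> into itself; Brouwer's theorem applies. In contrast to the inverse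
  function theorem, this asks for differentiability at the single point \<open>y\<close> and continuity around it.
\<close>

lemma first_order_solution_of_perturbed_identity:
  fixes F :: "'a::euclidean_space \<Rightarrow> 'a"
  assumes U: "open U" "y \<in> U" and F: "continuous_on U F" "F y = y"
    and F': "(F has_derivative (\<lambda>h. h)) (at y)" and "e > 0"
  obtains t x where "t > 0" "x \<in> U" "F x = y + t *\<^sub>R w" "norm (x - (y + t *\<^sub>R w)) \<le> e * t"
proof -
  define C where "C = norm w + e"
  have "C > 0" using \<open>e > 0\<close> unfolding C_def by (simp add: add_nonneg_pos)
  have "e / C > 0" using \<open>e > 0\<close> \<open>C > 0\<close> by simp
  then obtain d where "d > 0" and
    d': "\<forall>x. norm (x - y) < d \<longrightarrow> norm (F x - F y - (x - y)) \<le> e / C * norm (x - y)"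
    using F' unfolding has_derivative_at_alt by blast
  have d: "norm (F x - x) \<le> e / C * norm (x - y)" if "norm (x - y) < d" for x
    using d'[rule_format, OF that] by (simp add: F(2))
  obtain r where "r > 0" and r: "ball y r \<subseteq> U"
    using U open_contains_ball by blast
  define t where "t = min d r / (2 * C)"
  have "t > 0" using \<open>d > 0\<close> \<open>r > 0\<close> \<open>C > 0\<close> by (simp add: t_def)
  have "t * C < min d r" using \<open>d > 0\<close> \<open>r > 0\<close> \<open>C > 0\<close> by (auto simp: t_def field_simps min_def)
  define c where "c = y + t *\<^sub>R w"
  have near: "norm (x - y) \<le> t * C" if "x \<in> cball c (e * t)" for x
  proof -
    have "norm (x - y) \<le> norm (x - c) + norm (t *\<^sub>R w)"
      using norm_triangle_ineq[of "x - c" "t *\<^sub>R w"] by (simp add: c_def)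
    also have "\<dots> \<le> t * C"
      using that \<open>t > 0\<close> by (simp add: C_def dist_norm norm_minus_commute algebra_simps)
    finally show ?thesis .
  qed
  have sub: "cball c (e * t) \<subseteq> U"
    using near \<open>t * C < min d r\<close> r by (force simp: dist_norm norm_minus_commute)
  obtain x where x: "x \<in> cball c (e * t)" "c + x - F x = x"
  proof (rule brouwer_ball[of "e * t" c "\<lambda>x. c + x - F x"])
    show "0 < e * t" using \<open>e > 0\<close> \<open>t > 0\<close> by simp
    show "continuous_on (cball c (e * t)) (\<lambda>x. c + x - F x)"
      by (intro continuous_intros continuous_on_subset[OF F(1) sub])
    show "(\<lambda>x. c + x - F x) \<in> cball c (e * t) \<rightarrow> cball c (e * t)"
    proof
      fix x assume "x \<in> cball c (e * t)"
      then have "norm (x - y) \<le> t * C" by (rule near)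
      then have "norm (F x - x) \<le> e / C * (t * C)"
        using d[of x] \<open>t * C < min d r\<close> \<open>e > 0\<close> \<open>C > 0\<close>
        by (smt (verit) divide_pos_pos mult_left_mono)
      also have "\<dots> = e * t" using \<open>C > 0\<close> by simp
      finally show "c + x - F x \<in> cball c (e * t)"
        by (simp add: dist_norm algebra_simps)
    qed
  qed auto
  show thesis
  proof (rule that[of t x])
    show "F x = y + t *\<^sub>R w" using x(2) by (simp add: c_def algebra_simps)
    show "norm (x - (y + t *\<^sub>R w)) \<le> e * t"
      using x(1) by (simp add: c_def dist_norm norm_minus_commute)
  qed (use \<open>t > 0\<close> sub x(1) in auto)
qed

text \<open>
  Let \<open>a k\<close> be the gradients of the active constraints \<open>G k\<close> and \<open>b k\<close> a family dual to them.
  The map \<open>F x = x + (\<Sum>k. (G k x - a k \<bullet> (x - y)) b k)\<close> straightens the constraints: it has derivative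
  the identity at \<open>y\<close>, and \<open>a k \<bullet> (F x - y) = G k x\<close>. Solving \<open>F x = y + t w\<close> to first order therefore
  yields feasible points in every direction \<open>w\<close> allowed by the linearized constraints, so the objective
  cannot decrease to first order along such \<open>w\<close>. Two choices of \<open>w\<close> then suffice in place of Farkas'
  lemma: the part of the negative objective gradient orthogonal to all \<open>a k\<close>, which must vanish, and
  \<open>- b k\<close> for an active inequality \<open>k\<close>, which shows that its multiplier is nonnegative.
\<close>

theorem locally_optimal_licq_imp_kkt:
  fixes f :: "'a::euclidean_space \<Rightarrow> real"
  assumes fin: "finite I" "finite J"
    and U: "open U" "y \<in> U"
    and cont: "\<And>i. i \<in> I \<Longrightarrow> continuous_on U (g i)" "\<And>j. j \<in> J \<Longrightarrow> continuous_on U (h j)"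
    and diff: "f differentiable at y" "\<And>i. i \<in> I \<Longrightarrow> g i differentiable at y"
      "\<And>j. j \<in> J \<Longrightarrow> h j differentiable at y"
    and licq: "licq I g J h y"
    and opt: "locally_optimal f (feasible_set I g J h) y"
  shows "\<exists>lam mu. kkt f I g J h y lam mu"
proof -
  define K where "K = I <+> {j \<in> J. h j y = 0}"
  define G where "G = case_sum g h"
  define a where "a = case_sum (\<lambda>i. gradient (g i) y) (\<lambda>j. gradient (h j) y)"
  have a_simps [simp]: "a (Inl i) = gradient (g i) y" "a (Inr j) = gradient (h j) y" for i j
    by (simp_all add: a_def)
  have K_iff [simp]: "Inl i \<in> K \<longleftrightarrow> i \<in> I" "Inr j \<in> K \<longleftrightarrow> j \<in> J \<and> h j y = 0" for i j
    by (auto simp: K_def)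
  have finK: "finite K" using fin by (simp add: K_def)
  have "inj_on a K" "independent (a ` K)"
    using licq unfolding licq_def Let_def K_def a_def by auto
  then obtain b where
    b_dual: "\<And>k l. k \<in> K \<Longrightarrow> l \<in> K \<Longrightarrow> inner (a l) (b k) = (if l = k then 1 else 0)"
    using dual_family_exists[of a K] by blast
  have feas: "\<And>i. i \<in> I \<Longrightarrow> g i y = 0" "\<And>j. j \<in> J \<Longrightarrow> h j y \<le> 0"
    using opt by (auto simp: locally_optimal_def feasible_set_def)
  have G0: "G k y = 0" if "k \<in> K" for k
    using that feas by (auto simp: K_def G_def)
  have G_deriv: "(G k has_derivative (\<lambda>v. inner (a k) v)) (at y)" if "k \<in> K" for k
    using that diff(2,3)[THEN differentiable_imp_GDERIV_gradient]
    by (auto simp: K_def G_def gderiv_def inner_commute)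
  have G_cont: "continuous_on U (G k)" if "k \<in> K" for k
    using that cont by (auto simp: K_def G_def)
  have f_deriv: "(f has_derivative (\<lambda>v. inner (gradient f y) v)) (at y)"
    using differentiable_imp_GDERIV_gradient[OF diff(1)] by (simp add: gderiv_def inner_commute)

  define F where "F x = x + (\<Sum>k\<in>K. (G k x - inner (a k) (x - y)) *\<^sub>R b k)" for x
  have F_cont: "continuous_on U F"
    unfolding F_def by (intro continuous_intros G_cont)
  have F_y: "F y = y" by (simp add: F_def G0)
  have F_deriv: "(F has_derivative (\<lambda>v. v)) (at y)"
    unfolding F_def
    by (rule derivative_eq_intros G_deriv refl | assumption | simp)+
  have F_coord: "inner (a k) (F x - y) = G k x" if "k \<in> K" for k x
  proof -
    have "inner (a k) (F x - y) =
        inner (a k) (x - y) + (\<Sum>l\<in>K. (G l x - inner (a l) (x - y)) * inner (a k) (b l))"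
      by (simp add: F_def inner_diff_right inner_add_right inner_sum_right)
    also have "(\<Sum>l\<in>K. (G l x - inner (a l) (x - y)) * inner (a k) (b l)) =
        (\<Sum>l\<in>K. if k = l then G l x - inner (a l) (x - y) else 0)"
      using that by (intro sum.cong) (auto simp: b_dual)
    also have "\<dots> = G k x - inner (a k) (x - y)"
      using that finK by simp
    finally show ?thesis by simp
  qed

  obtain U' where U': "open U'" "y \<in> U'" "\<And>x. x \<in> U' \<Longrightarrow> x \<in> feasible_set I g J h \<Longrightarrow> f y \<le> f x"
    using opt by (auto simp: locally_optimal_def)
  have "\<forall>\<^sub>F x in nhds y. \<forall>j\<in>{j\<in>J. h j y < 0}. h j x < 0"
  proof (intro eventually_ball_finite ballI)
    fix j assume j: "j \<in> {j \<in> J. h j y < 0}"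
    then have "isCont (h j) y"
      using cont(2) U continuous_on_eq_continuous_at by blast
    then have "filterlim (h j) (nhds (h j y)) (nhds y)"
      by (simp add: isCont_def tendsto_at_iff_tendsto_nhds)
    then show "\<forall>\<^sub>F x in nhds y. h j x < 0"
      using j by (auto intro: order_tendstoD(2))
  qed (use fin in auto)
  then obtain V where V: "open V" "y \<in> V" "\<And>x j. x \<in> V \<Longrightarrow> j \<in> J \<Longrightarrow> h j y < 0 \<Longrightarrow> h j x < 0"
    by (auto simp: eventually_nhds)

  \<comment> \<open>Feasible points near \<open>y\<close> in the direction \<open>w\<close> exist by straightening the constraints.\<close>
  have descent: "0 \<le> inner (gradient f y) w"
    if w: "\<And>i. i \<in> I \<Longrightarrow> inner (gradient (g i) y) w = 0"
      "\<And>j. j \<in> J \<Longrightarrow> h j y = 0 \<Longrightarrow> inner (gradient (h j) y) w \<le> 0" for w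
  proof (rule ccontr)
    define c where "c = - inner (gradient f y) w"
    assume "\<not> 0 \<le> inner (gradient f y) w"
    then have "c > 0" by (simp add: c_def)
    \<comment> \<open>The slope along \<open>w\<close> is \<open>- c\<close>. With the following \<open>e\<close> and \<open>\<eta>\<close>, the deviation of \<open>x\<close> from
      \<open>y + t w\<close> and the remainder of \<open>f\<close> change the decrease \<open>t c\<close> by at most \<open>t c / 4\<close> each.\<close>
    define n where "n = norm (gradient f y) + 1"
    have "n > 0" by (simp add: n_def add_nonneg_pos)
    define e where "e = c / (4 * n)"
    have "e > 0" using \<open>c > 0\<close> \<open>n > 0\<close> by (simp add: e_def)
    define s where "s = norm w + e"
    have "s > 0" using \<open>e > 0\<close> by (simp add: s_def add_nonneg_pos)
    define \<eta> where "\<eta> = c / (4 * s)"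
    have "\<eta> > 0" using \<open>c > 0\<close> \<open>s > 0\<close> by (simp add: \<eta>_def)
    then obtain d where "d > 0" and
      d: "\<forall>x. norm (x - y) < d \<longrightarrow>
        norm (f x - f y - inner (gradient f y) (x - y)) \<le> \<eta> * norm (x - y)"
      using f_deriv unfolding has_derivative_at_alt by blast
    define W where "W = U \<inter> U' \<inter> V \<inter> ball y d"
    have W: "open W" "y \<in> W" "W \<subseteq> U"
      using U U'(1,2) V(1,2) \<open>d > 0\<close> by (auto simp: W_def)
    obtain t x where tx: "t > 0" "x \<in> W" "F x = y + t *\<^sub>R w" "norm (x - (y + t *\<^sub>R w)) \<le> e * t"
      using first_order_solution_of_perturbed_identity[OF W(1,2)
          continuous_on_subset[OF F_cont W(3)] F_y F_deriv \<open>e > 0\<close>] .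
    have Gx: "G k x = t * inner (a k) w" if "k \<in> K" for k
      using F_coord[OF that, of x] by (simp add: tx(3))
    have "g i x = 0" if "i \<in> I" for i
      using Gx[of "Inl i"] that w(1) by (simp add: G_def)
    moreover have "h j x \<le> 0" if "j \<in> J" for j
    proof (cases "h j y = 0")
      case True
      then show ?thesis
        using Gx[of "Inr j"] that w(2)[OF that] \<open>t > 0\<close> by (simp add: G_def mult_nonneg_nonpos)
    next
      case False
      then show ?thesis
        using V(3)[of x j] feas(2)[OF that] that tx(2) by (force simp: W_def)
    qed
    ultimately have "f y \<le> f x"
      using U'(3)[of x] tx(2) by (simp add: W_def feasible_set_def)
    moreover have "f x < f y"
    proof -
      define v where "v = x - (y + t *\<^sub>R w)"
      have xy: "x - y = t *\<^sub>R w + v" by (simp add: v_def)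
      have v: "norm v \<le> e * t" using tx(4) by (simp add: v_def)
      have "norm (x - y) \<le> norm (t *\<^sub>R w) + norm v"
        unfolding xy by (rule norm_triangle_ineq)
      also have "\<dots> \<le> t * s"
        using v \<open>t > 0\<close> by (simp add: s_def algebra_simps)
      finally have "\<eta> * norm (x - y) \<le> \<eta> * (t * s)"
        using \<open>\<eta> > 0\<close> by simp
      also have "\<dots> = t * c / 4"
        using \<open>s > 0\<close> by (simp add: \<eta>_def)
      finally have le: "\<eta> * norm (x - y) \<le> t * c / 4" .
      have "norm (x - y) < d"
        using tx(2) by (simp add: W_def dist_norm norm_minus_commute)
      with d have "norm (f x - f y - inner (gradient f y) (x - y)) \<le> \<eta> * norm (x - y)"
        by blast
      with le have 1: "f x - f y - inner (gradient f y) (x - y) \<le> t * c / 4"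
        by simp
      have "inner (gradient f y) v \<le> norm (gradient f y) * norm v"
        by (rule norm_cauchy_schwarz)
      also have "\<dots> \<le> n * (e * t)"
        using v \<open>n > 0\<close> by (intro mult_mono) (auto simp: n_def)
      also have "\<dots> = t * c / 4"
        using \<open>n > 0\<close> by (simp add: e_def)
      finally have 2: "inner (gradient f y) (x - y) \<le> - (t * c) + t * c / 4"
        unfolding xy inner_add_right by (simp add: c_def)
      have "t * c > 0" using \<open>t > 0\<close> \<open>c > 0\<close> by simp
      then show ?thesis using 1 2 by linarith
    qed
    ultimately show False by simp
  qed

  \<comment> \<open>The part \<open>r\<close> of the negative gradient is itself an allowed direction, along which \<open>f\<close> has slope
    \<open>- (r \<bullet> r)\<close>.\<close>
  obtain p r where p: "p \<in> span (a ` K)" and r: "\<And>w. w \<in> span (a ` K) \<Longrightarrow> orthogonal r w"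
    and pr: "- gradient f y = p + r"
    using orthogonal_subspace_decomp_exists by blast
  have r_a: "inner (a k) r = 0" if "k \<in> K" for k
    using r[of "a k"] that by (simp add: span_base orthogonal_def inner_commute)
  have "0 \<le> inner (gradient f y) r"
  proof (rule descent)
    show "inner (gradient (g i) y) r = 0" if "i \<in> I" for i
      using r_a[of "Inl i"] that by simp
    show "inner (gradient (h j) y) r \<le> 0" if "j \<in> J" "h j y = 0" for j
      using r_a[of "Inr j"] that by simp
  qed
  also have "inner (gradient f y) r = - inner (p + r) r"
    unfolding pr[symmetric] by simp
  also have "\<dots> = - inner r r"
    using r[OF p] by (simp add: inner_add_left orthogonal_def inner_commute[of p r])
  finally have "inner r r = 0"
    using inner_ge_zero[of r] by linarith
  then have "r = 0" by simp

  obtain c where "p = (\<Sum>v\<in>a ` K. c v *\<^sub>R v)"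
    using p unfolding span_finite[OF finite_imageI[OF finK]] by (rule rangeE)
  then have "p = (\<Sum>k\<in>K. c (a k) *\<^sub>R a k)"
    using \<open>inj_on a K\<close> by (simp add: sum.reindex)
  then obtain \<nu> where \<nu>: "- gradient f y = (\<Sum>k\<in>K. \<nu> k *\<^sub>R a k)"
    using pr \<open>r = 0\<close> that[of "\<lambda>k. c (a k)"] by simp
  \<comment> \<open>Pairing with \<open>b (Inr j)\<close> isolates the multiplier of \<open>j\<close>; the direction \<open>- b (Inr j)\<close> leaves all
    other active constraints unchanged to first order.\<close>
  have \<nu>_nonneg: "0 \<le> \<nu> (Inr j)" if "j \<in> J" "h j y = 0" for j
  proof -
    have k: "Inr j \<in> K" using that by simp
    have "- inner (gradient f y) (b (Inr j)) = (\<Sum>l\<in>K. \<nu> l * inner (a l) (b (Inr j)))"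
      unfolding inner_minus_left[symmetric] \<nu> by (simp add: inner_sum_left)
    also have "\<dots> = (\<Sum>l\<in>K. if l = Inr j then \<nu> l else 0)"
      using k by (intro sum.cong) (auto simp: b_dual)
    also have "\<dots> = \<nu> (Inr j)"
      using k finK by simp
    finally have "\<nu> (Inr j) = inner (gradient f y) (- b (Inr j))"
      by simp
    also have "\<dots> \<ge> 0"
    proof (rule descent)
      show "inner (gradient (g i) y) (- b (Inr j)) = 0" if "i \<in> I" for i
        using b_dual[OF k, of "Inl i"] that by simp
      show "inner (gradient (h j') y) (- b (Inr j)) \<le> 0" if "j' \<in> J" "h j' y = 0" for j'
        using b_dual[OF k, of "Inr j'"] that by simp
    qed
    finally show ?thesis .
  qed
  have "(\<Sum>k\<in>K. \<nu> k *\<^sub>R a k) = (\<Sum>i\<in>I. \<nu> (Inl i) *\<^sub>R gradient (g i) y) +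
      (\<Sum>j\<in>{j\<in>J. h j y = 0}. \<nu> (Inr j) *\<^sub>R gradient (h j) y)"
    unfolding K_def using fin by (subst sum.Plus) auto
  also have "(\<Sum>j\<in>{j\<in>J. h j y = 0}. \<nu> (Inr j) *\<^sub>R gradient (h j) y) =
      (\<Sum>j\<in>J. (if h j y = 0 then \<nu> (Inr j) else 0) *\<^sub>R gradient (h j) y)"
    using fin by (intro sum.mono_neutral_cong_left) auto
  finally have "kkt f I g J h y (\<lambda>i. \<nu> (Inl i)) (\<lambda>j. if h j y = 0 then \<nu> (Inr j) else 0)"
    using feas \<nu>_nonneg unfolding kkt_def \<nu> by (auto intro!: sum.neutral)
  then show ?thesis by blast
qed

section \<open>Gradients of the network constraints\<close>

text \<open>
  The DNR objective as a function of \<open>z\<close> alone; it is the objective \<open>w\<close> of the auxiliary model that is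
  used below.
\<close>

definition line_loss :: "('n::finite, 'l::finite) network \<Rightarrow> ('n, 'l) zvar \<Rightarrow> real" where
  "line_loss N z = (\<Sum>e\<in>UNIV. res N e * ll z $ e)"

lemma zvar_component_differentiable [derivative_intros]:
  fixes z :: "('n::finite, 'l::finite) zvar"
  shows "(\<lambda>z. vv z $ i) differentiable at z" "(\<lambda>z. pp z $ e) differentiable at z"
    "(\<lambda>z. qq z $ e) differentiable at z" "(\<lambda>z. ll z $ e) differentiable at z"
  by (rule linear_imp_differentiable, rule linearI, simp, simp)+

lemma drop_residual_differentiable: "drop_residual N e differentiable at z"
  unfolding drop_residual_def[abs_def] by (intro derivative_intros)

lemma fix_eq_differentiable: "fix_eq N c differentiable at z"
  by (cases c) (auto intro!: derivative_intros drop_residual_differentiable)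

lemma fix_ineq_differentiable: "fix_ineq N c differentiable at z"
  by (cases c) (auto intro!: derivative_intros)

lemma line_loss_differentiable: "line_loss N differentiable at z"
  unfolding line_loss_def[abs_def]
  by (intro differentiable_sum differentiable_mult differentiable_const zvar_component_differentiable ballI) simp

text \<open>
  Up to sign, a power limit has the gradient of the component that it bounds, and so does the
  switched-off constraint on that component. Writing every gradient through \<^const>\<open>fix_eq\<close> lets one coefficient
  comparison per line serve both the lines inside and the lines outside the tree.
\<close>

lemma gradient_fix_ineq:
  "gradient (fix_ineq N (FPLo e)) z = - gradient (fix_eq N (FPOff e)) z"
  "gradient (fix_ineq N (FPUp e)) z = gradient (fix_eq N (FPOff e)) z"
  "gradient (fix_ineq N (FQLo e)) z = - gradient (fix_eq N (FQOff e)) z"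
  "gradient (fix_ineq N (FQUp e)) z = gradient (fix_eq N (FQOff e)) z"
  using gradient_const_plus[of "\<lambda>z. - pp z $ e" z "- Pmax N e"]
    gradient_const_plus[of "\<lambda>z. pp z $ e" z "- Pmax N e"]
    gradient_const_plus[of "\<lambda>z. - qq z $ e" z "- Qmax N e"]
    gradient_const_plus[of "\<lambda>z. qq z $ e" z "- Qmax N e"]
  by (simp_all add: gradient_minus zvar_component_differentiable)

lemma gradient_dnr_obj: "gradient (dnr_obj N) (z, u) = (gradient (line_loss N) z, 0)"
  using gradient_sum_of_separate_variables[OF line_loss_differentiable GDERIV_const[of 0]]
  by (simp add: dnr_obj_def line_loss_def[abs_def])

lemma gradient_dnr_eq:
  "gradient (dnr_eq N d (Flow e)) (z, u) = (gradient (fix_eq N (FFlow e)) z, 0)"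
  "gradient (dnr_eq N d (Binary e)) (z, u) = (0, (2 * u $ e - 1) *\<^sub>R axis e 1)"
proof -
  show "gradient (dnr_eq N d (Flow e)) (z, u) = (gradient (fix_eq N (FFlow e)) z, 0)"
    using gradient_sum_of_separate_variables[OF fix_eq_differentiable[of N "FFlow e" z]
        GDERIV_const[of 0 u]]
    by simp
  have "GDERIV (\<lambda>u. u $ e * (u $ e - 1)) u :>
      (u $ e) *\<^sub>R (axis e 1 - 0) + (u $ e - 1) *\<^sub>R axis e 1"
    by (intro GDERIV_mult GDERIV_diff GDERIV_vec_nth GDERIV_const)
  then have *: "GDERIV (\<lambda>u. u $ e * (u $ e - 1)) u :> (2 * u $ e - 1) *\<^sub>R axis e 1"
    by (rule GDERIV_subst) (simp add: algebra_simps flip: scaleR_2)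
  have "(\<lambda>z :: ('a, 'b) zvar. 0 :: real) differentiable at z" by simp
  from gradient_sum_of_separate_variables[OF this *] GDERIV_imp_gradient_eq[OF GDERIV_const]
  show "gradient (dnr_eq N d (Binary e)) (z, u) = (0, (2 * u $ e - 1) *\<^sub>R axis e 1)"
    by simp
qed

text \<open>
  In the \<open>z\<close> direction a relaxed constraint has the gradient of its fixed counterpart, whatever
  the value of \<open>u\<close>; the switching enters through a multiple of one coordinate vector of \<open>u\<close>.
\<close>

lemma gradient_dnr_ineq:
  "gradient (dnr_ineq N (DropLo e)) (z, u) = (- gradient (fix_eq N (FDrop e)) z, bigM N *\<^sub>R axis e 1)"
  "gradient (dnr_ineq N (DropUp e)) (z, u) = (gradient (fix_eq N (FDrop e)) z, bigM N *\<^sub>R axis e 1)"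
  "gradient (dnr_ineq N (PLo e)) (z, u) = (- gradient (fix_eq N (FPOff e)) z, - Pmax N e *\<^sub>R axis e 1)"
  "gradient (dnr_ineq N (PUp e)) (z, u) = (gradient (fix_eq N (FPOff e)) z, - Pmax N e *\<^sub>R axis e 1)"
  "gradient (dnr_ineq N (QLo e)) (z, u) = (- gradient (fix_eq N (FQOff e)) z, - Qmax N e *\<^sub>R axis e 1)"
  "gradient (dnr_ineq N (QUp e)) (z, u) = (gradient (fix_eq N (FQOff e)) z, - Qmax N e *\<^sub>R axis e 1)"
  "gradient (dnr_ineq N (VLo i)) (z, u) = (gradient (fix_ineq N (FVLo i)) z, 0)"
  "gradient (dnr_ineq N (VUp i)) (z, u) = (gradient (fix_ineq N (FVUp i)) z, 0)"
proof -
  have pos: "gradient (\<lambda>(z, u). fix_eq N c z + (k + a * u $ e)) (z, u) =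
      (gradient (fix_eq N c) z, a *\<^sub>R axis e 1)" for c k a
    by (rule gradient_sum_of_separate_variables[OF fix_eq_differentiable GDERIV_affine_component])
  have neg: "gradient (\<lambda>(z, u). - fix_eq N c z + (k + a * u $ e)) (z, u) =
      (- gradient (fix_eq N c) z, a *\<^sub>R axis e 1)" for c k a
    using gradient_sum_of_separate_variables
      [OF differentiable_minus[OF fix_eq_differentiable] GDERIV_affine_component]
    by (simp add: gradient_minus[OF fix_eq_differentiable])
  note vol = gradient_sum_of_separate_variables[OF fix_ineq_differentiable[of N _ z] GDERIV_const[of 0 u]]
  show "gradient (dnr_ineq N (DropLo e)) (z, u) = (- gradient (fix_eq N (FDrop e)) z, bigM N *\<^sub>R axis e 1)"
    using neg[of "FDrop e" "- bigM N" "bigM N"] by (simp add: algebra_simps)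
  show "gradient (dnr_ineq N (DropUp e)) (z, u) = (gradient (fix_eq N (FDrop e)) z, bigM N *\<^sub>R axis e 1)"
    using pos[of "FDrop e" "- bigM N" "bigM N"] by (simp add: algebra_simps)
  show "gradient (dnr_ineq N (PLo e)) (z, u) = (- gradient (fix_eq N (FPOff e)) z, - Pmax N e *\<^sub>R axis e 1)"
  proof -
    have "dnr_ineq N (PLo e) = (\<lambda>(z, u). - fix_eq N (FPOff e) z + (0 + - Pmax N e * u $ e))"
      by (simp add: fun_eq_iff)
    then show ?thesis by (simp only: neg)
  qed
  show "gradient (dnr_ineq N (PUp e)) (z, u) = (gradient (fix_eq N (FPOff e)) z, - Pmax N e *\<^sub>R axis e 1)"
    using pos[of "FPOff e" 0 "- Pmax N e"] by (simp add: algebra_simps)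
  show "gradient (dnr_ineq N (QLo e)) (z, u) = (- gradient (fix_eq N (FQOff e)) z, - Qmax N e *\<^sub>R axis e 1)"
  proof -
    have "dnr_ineq N (QLo e) = (\<lambda>(z, u). - fix_eq N (FQOff e) z + (0 + - Qmax N e * u $ e))"
      by (simp add: fun_eq_iff)
    then show ?thesis by (simp only: neg)
  qed
  show "gradient (dnr_ineq N (QUp e)) (z, u) = (gradient (fix_eq N (FQOff e)) z, - Qmax N e *\<^sub>R axis e 1)"
    using pos[of "FQOff e" 0 "- Qmax N e"] by (simp add: algebra_simps)
  show "gradient (dnr_ineq N (VLo i)) (z, u) = (gradient (fix_ineq N (FVLo i)) z, 0)"
    using vol[of "FVLo i"] by simp
  show "gradient (dnr_ineq N (VUp i)) (z, u) = (gradient (fix_ineq N (FVUp i)) z, 0)"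
    using vol[of "FVUp i"] by simp
qed

section \<open>Sums over the constraint indices\<close>

lemma sum_dnr_eq_idx:
  fixes F :: "('n::finite, 'l::finite) dnr_eq_idx \<Rightarrow> 'a::comm_monoid_add"
  shows "sum F UNIV = (\<Sum>j\<in>UNIV. F (PBal j)) + (\<Sum>j\<in>UNIV. F (QBal j)) +
    (\<Sum>e\<in>UNIV. F (Flow e)) + (\<Sum>e\<in>UNIV. F (Binary e)) + F LineCount"
proof -
  have *: "(UNIV :: ('n, 'l) dnr_eq_idx set) =
      range PBal \<union> range QBal \<union> range Flow \<union> range Binary \<union> {LineCount}"
    (is "_ = ?R")
  proof -
    have "c \<in> ?R" for c by (cases c) auto
    then show ?thesis by blast
  qed
  show ?thesis
    unfolding *
    by (subst sum.union_disjoint, simp, simp, blast)+ (simp add: sum.reindex inj_on_def)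
qed

lemma sum_dnr_ineq_idx:
  fixes F :: "('n::finite, 'l::finite) dnr_ineq_idx \<Rightarrow> 'a::comm_monoid_add"
  shows "sum F UNIV = (\<Sum>e\<in>UNIV. F (DropLo e)) + (\<Sum>e\<in>UNIV. F (DropUp e)) +
    (\<Sum>e\<in>UNIV. F (PLo e)) + (\<Sum>e\<in>UNIV. F (PUp e)) + (\<Sum>e\<in>UNIV. F (QLo e)) + (\<Sum>e\<in>UNIV. F (QUp e)) +
    (\<Sum>i\<in>UNIV. F (VLo i)) + (\<Sum>i\<in>UNIV. F (VUp i)) + (\<Sum>j\<in>UNIV. F (Degree j))"
proof -
  have *: "(UNIV :: ('n, 'l) dnr_ineq_idx set) =
      range DropLo \<union> range DropUp \<union> range PLo \<union> range PUp \<union> range QLo \<union> range QUp \<union>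
      range VLo \<union> range VUp \<union> range Degree"
    (is "_ = ?R")
  proof -
    have "c \<in> ?R" for c by (cases c) auto
    then show ?thesis by blast
  qed
  show ?thesis
    unfolding *
    by (subst sum.union_disjoint, simp, simp, blast)+ (simp add: sum.reindex inj_on_def)
qed

lemma sum_fix_eqs:
  fixes F :: "'l::finite fix_eq_idx \<Rightarrow> 'a::comm_monoid_add"
  shows "sum F (fix_eqs T) = (\<Sum>e\<in>T. F (FDrop e)) + (\<Sum>e\<in>UNIV. F (FFlow e)) +
    (\<Sum>e\<in>-T. F (FPOff e)) + (\<Sum>e\<in>-T. F (FQOff e))"
  unfolding fix_eqs_def
  by (subst sum.union_disjoint, simp, simp, blast)+ (simp add: sum.reindex inj_on_def)

lemma sum_fix_ineqs:
  fixes F :: "('n::finite, 'l::finite) fix_ineq_idx \<Rightarrow> 'a::comm_monoid_add"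
  shows "sum F (fix_ineqs T) = (\<Sum>e\<in>T. F (FPLo e)) + (\<Sum>e\<in>T. F (FPUp e)) +
    (\<Sum>e\<in>T. F (FQLo e)) + (\<Sum>e\<in>T. F (FQUp e)) + (\<Sum>i\<in>UNIV. F (FVLo i)) + (\<Sum>i\<in>UNIV. F (FVUp i))"
  unfolding fix_ineqs_def
  by (subst sum.union_disjoint, simp, simp, blast)+ (simp add: sum.reindex inj_on_def)

section \<open>Reduction to the fixed constraints\<close>

text \<open>
  Generation is bounded by no constraint and enters neither the objective nor the fixed
  constraints. Overwriting it with the values that the balance equations prescribe therefore turns
  any point into one that satisfies these equations, at no cost.
\<close>

definition balancing_generation ::
  "('n::finite, 'l::finite) network \<Rightarrow> 'n load \<Rightarrow> ('n, 'l) zvar \<Rightarrow> ('n, 'l) zvar" where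
  "balancing_generation N d z =
    (\<chi> j. fst d $ j +
       ((\<Sum>e\<in>lines_in N j. res N e * ll z $ e - pp z $ e) + (\<Sum>e\<in>lines_out N j. pp z $ e)),
     \<chi> j. snd d $ j +
       ((\<Sum>e\<in>lines_in N j. rea N e * ll z $ e - qq z $ e) + (\<Sum>e\<in>lines_out N j. qq z $ e)),
     snd (snd z))"

lemma fix_balancing_generation [simp]:
  "fix_eq N c (balancing_generation N d z) = fix_eq N c z"
  "fix_ineq N k (balancing_generation N d z) = fix_ineq N k z"
  "line_loss N (balancing_generation N d z) = line_loss N z"
proof -
  show "fix_eq N c (balancing_generation N d z) = fix_eq N c z"
    by (cases c) (simp_all add: balancing_generation_def drop_residual_def)
  show "fix_ineq N k (balancing_generation N d z) = fix_ineq N k z"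
    by (cases k) (simp_all add: balancing_generation_def)
  show "line_loss N (balancing_generation N d z) = line_loss N z"
    by (simp add: balancing_generation_def line_loss_def)
qed

lemma continuous_balancing_generation: "continuous_on UNIV (balancing_generation N d)"
  unfolding balancing_generation_def[abs_def] by (intro continuous_intros)

lemma balancing_generation_fixes_feasible:
  assumes "(z, u) \<in> dnr_feasible N d"
  shows "balancing_generation N d z = z"
proof -
  have "dnr_eq N d (PBal j) (z, u) = 0" "dnr_eq N d (QBal j) (z, u) = 0" for j
    using assms unfolding dnr_feasible_def feasible_set_def by blast+
  then have "gP (balancing_generation N d z) $ j = gP z $ j"
    "gQ (balancing_generation N d z) $ j = gQ z $ j" for j
    by (simp_all add: balancing_generation_def diff_eq_eq add.commute)
  then show ?thesis
    by (simp add: prod_eq_iff vec_eq_iff) (simp add: balancing_generation_def)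
qed

lemma dnr_feasible_binary:
  assumes "(z, u) \<in> dnr_feasible N d"
  shows "u $ e = 0 \<or> u $ e = 1"
proof -
  have "dnr_eq N d (Binary e) (z, u) = 0"
    using assms unfolding dnr_feasible_def feasible_set_def by blast
  then show ?thesis by simp
qed

text \<open>
  At a binary \<open>u\<close> the paired inequalities close up to equalities: the voltage drop on switched-on
  lines, where the \<open>M\<close> term vanishes, and the zero flow on switched-off lines, where the limits do.
\<close>

lemma dnr_feasible_imp_Z_set:
  assumes feas: "(z, u) \<in> dnr_feasible N d"
  shows "z \<in> Z_set N {e. u $ e = 1}"
proof -
  have eq: "dnr_eq N d c (z, u) = 0" and ineq: "dnr_ineq N k (z, u) \<le> 0" for c k
    using feas by (auto simp: dnr_feasible_def feasible_set_def)
  have "fix_eq N c z = 0" if "c \<in> fix_eqs {e. u $ e = 1}" for c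
  proof (cases c)
    case (FDrop e)
    then show ?thesis
      using that ineq[of "DropLo e"] ineq[of "DropUp e"] by (auto simp: fix_eqs_def)
  next
    case (FFlow e)
    then show ?thesis using eq[of "Flow e"] by simp
  next
    case (FPOff e)
    then have "u $ e = 0"
      using that dnr_feasible_binary[OF feas, of e] by (auto simp: fix_eqs_def)
    then show ?thesis
      using FPOff ineq[of "PLo e"] ineq[of "PUp e"] by simp
  next
    case (FQOff e)
    then have "u $ e = 0"
      using that dnr_feasible_binary[OF feas, of e] by (auto simp: fix_eqs_def)
    then show ?thesis
      using FQOff ineq[of "QLo e"] ineq[of "QUp e"] by simp
  qed
  moreover have "fix_ineq N k z \<le> 0" if "k \<in> fix_ineqs {e. u $ e = 1}" for k
  proof (cases k)
    case (FPLo e)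
    then show ?thesis using that ineq[of "PLo e"] by (auto simp: fix_ineqs_def)
  next
    case (FPUp e)
    then show ?thesis using that ineq[of "PUp e"] by (auto simp: fix_ineqs_def)
  next
    case (FQLo e)
    then show ?thesis using that ineq[of "QLo e"] by (auto simp: fix_ineqs_def)
  next
    case (FQUp e)
    then show ?thesis using that ineq[of "QUp e"] by (auto simp: fix_ineqs_def)
  next
    case (FVLo i)
    then show ?thesis using ineq[of "VLo i"] by simp
  next
    case (FVUp i)
    then show ?thesis using ineq[of "VUp i"] by simp
  qed
  ultimately show ?thesis
    unfolding Z_set_def feasible_set_def by blast
qed

lemma bigM_sufficient_strict:
  assumes "bigM_sufficient N D" "d \<in> D" "(z, u) \<in> dnr_feasible N d" "u $ e = 0"
  shows "dnr_ineq N (DropLo e) (z, u) < 0" "dnr_ineq N (DropUp e) (z, u) < 0"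
proof -
  have "(z, u) \<in> feasible_set UNIV (dnr_eq N d)
      (- (DropLo ` {e. u $ e = 0} \<union> DropUp ` {e. u $ e = 0})) (dnr_ineq N)"
    using assms(3) by (simp add: dnr_feasible_def feasible_set_def)
  with assms(1,2,4) show "dnr_ineq N (DropLo e) (z, u) < 0" "dnr_ineq N (DropUp e) (z, u) < 0"
    unfolding bigM_sufficient_def Let_def by blast+
qed

text \<open>
  The converse for a point \<open>z'\<close> with the same switching. The voltage drop of a switched-off line is
  not among the fixed constraints, so its relaxed bound has to be assumed; it holds near a feasible
  point because there it is strict.
\<close>

lemma Z_set_imp_dnr_feasible:
  assumes feas: "(z, u) \<in> dnr_feasible N d"
    and z': "z' \<in> Z_set N {e. u $ e = 1}"
    and off: "\<And>e. u $ e = 0 \<Longrightarrow> \<bar>drop_residual N e z'\<bar> < bigM N"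
  shows "(balancing_generation N d z', u) \<in> dnr_feasible N d"
proof -
  let ?T = "{e. u $ e = 1}" and ?z = "balancing_generation N d z'"
  note bin = dnr_feasible_binary[OF feas]
  have eq0: "dnr_eq N d c (z, u) = 0" and ineq0: "dnr_ineq N k (z, u) \<le> 0" for c k
    using feas by (auto simp: dnr_feasible_def feasible_set_def)
  have eq: "fix_eq N c ?z = 0" if "c \<in> fix_eqs ?T" for c
    using z' that by (simp add: Z_set_def feasible_set_def)
  have ineq: "fix_ineq N k ?z \<le> 0" if "k \<in> fix_ineqs ?T" for k
    using z' that by (simp add: Z_set_def feasible_set_def)
  have "dnr_eq N d c (?z, u) = 0" for c
  proof (cases c)
    case (Flow e)
    then show ?thesis using eq[of "FFlow e"] by (simp add: fix_eqs_def)
  next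
    case (Binary e)
    then show ?thesis using eq0[of "Binary e"] by simp
  next
    case LineCount
    then show ?thesis using eq0[of LineCount] by simp
  qed (simp_all add: balancing_generation_def)
  moreover have "dnr_ineq N k (?z, u) \<le> 0" for k
  proof -
    have drop: "drop_residual N e ?z = drop_residual N e z'" for e
      using fix_balancing_generation(1)[of N "FDrop e" d z'] by simp
    have on_off: "(u $ e = 1 \<and> drop_residual N e ?z = 0 \<and>
          - Pmax N e \<le> pp ?z $ e \<and> pp ?z $ e \<le> Pmax N e \<and>
          - Qmax N e \<le> qq ?z $ e \<and> qq ?z $ e \<le> Qmax N e) \<or>
        (u $ e = 0 \<and> \<bar>drop_residual N e ?z\<bar> < bigM N \<and> pp ?z $ e = 0 \<and> qq ?z $ e = 0)" for e
    proof (cases "u $ e = 1")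
      case True
      then show ?thesis
        using eq[of "FDrop e"] ineq[of "FPLo e"] ineq[of "FPUp e"] ineq[of "FQLo e"] ineq[of "FQUp e"]
        by (simp add: fix_eqs_def fix_ineqs_def del: fix_balancing_generation)
    next
      case False
      then show ?thesis
        using bin[of e] eq[of "FPOff e"] eq[of "FQOff e"] off[of e] 
        by (simp add: fix_eqs_def drop del: fix_balancing_generation)
    qed
    show ?thesis
    proof (cases k)
      case (VLo i)
      then show ?thesis using ineq[of "FVLo i"]
        by (simp add: fix_ineqs_def del: fix_balancing_generation)
    next
      case (VUp i)
      then show ?thesis using ineq[of "FVUp i"]
        by (simp add: fix_ineqs_def del: fix_balancing_generation)
    next
      case (Degree j)
      then show ?thesis using ineq0[of "Degree j"] by simp
    next
      case (DropLo e)
      then show ?thesis using on_off[of e] by auto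
    next
      case (DropUp e)
      then show ?thesis using on_off[of e] by auto
    next
      case (PLo e)
      then show ?thesis using on_off[of e] by auto
    next
      case (PUp e)
      then show ?thesis using on_off[of e] by auto
    next
      case (QLo e)
      then show ?thesis using on_off[of e] by auto
    next
      case (QUp e)
      then show ?thesis using on_off[of e] by auto
    qed
  qed
  ultimately show ?thesis
    by (simp add: dnr_feasible_def feasible_set_def)
qed

text \<open>
  A competitor \<open>z'\<close> close to \<open>z\<close> becomes a DNR competitor after balancing its generation. As balancing
  is continuous and leaves \<open>z\<close> itself unchanged, the balanced point is still close to \<open>z\<close>.
\<close>

lemma dnr_locally_optimal_imp_line_loss_locally_optimal:
  assumes M: "bigM_sufficient N D" "d \<in> D"
    and opt: "locally_optimal (dnr_obj N) (dnr_feasible N d) (z, u)"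
  shows "locally_optimal (line_loss N) (Z_set N {e. u $ e = 1}) z"
proof -
  let ?R = "balancing_generation N d"
  have feas: "(z, u) \<in> dnr_feasible N d"
    using opt by (simp add: locally_optimal_def)
  obtain U where U: "open U" "(z, u) \<in> U"
    "\<And>y. y \<in> U \<Longrightarrow> y \<in> dnr_feasible N d \<Longrightarrow> dnr_obj N (z, u) \<le> dnr_obj N y"
    using opt by (auto simp: locally_optimal_def)
  define V where "V = (\<lambda>z'. (?R z', u)) -` U \<inter>
    (\<Inter>e\<in>{e. u $ e = 0}. {z'. \<bar>drop_residual N e z'\<bar> < bigM N})"
  have "continuous_on UNIV (drop_residual N e)" for e
    by (intro continuous_at_imp_continuous_on ballI differentiable_imp_continuous_within
        drop_residual_differentiable)
  then have "open {z'. \<bar>drop_residual N e z'\<bar> < bigM N}" for e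
    by (intro open_Collect_less continuous_intros)
  moreover have "open ((\<lambda>z'. (?R z', u)) -` U)"
    by (intro open_vimage U(1) continuous_intros continuous_balancing_generation)
  ultimately have "open V"
    unfolding V_def by (intro open_Int open_INT) auto
  moreover have "z \<in> V"
    using U(2) balancing_generation_fixes_feasible[OF feas] bigM_sufficient_strict[OF M feas]
    by (force simp: V_def abs_less_iff)
  moreover have "line_loss N z \<le> line_loss N z'"
    if "z' \<in> V" "z' \<in> Z_set N {e. u $ e = 1}" for z'
  proof -
    have "dnr_obj N (z, u) \<le> dnr_obj N (?R z', u)"
      using that by (intro U(3) Z_set_imp_dnr_feasible[OF feas]) (auto simp: V_def)
    then show ?thesis
      using fix_balancing_generation(3)[of N d z']
      by (simp add: dnr_obj_def line_loss_def)
  qed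
  ultimately show ?thesis
    using dnr_feasible_imp_Z_set[OF feas] unfolding locally_optimal_def by blast
qed


section \<open>Lagrange multipliers of the DNR model\<close>

lemma finite_fix_idx: "finite (fix_eqs T :: 'l::finite fix_eq_idx set)"
  "finite (fix_ineqs T :: ('n::finite, 'l::finite) fix_ineq_idx set)"
  by (simp_all add: fix_eqs_def fix_ineqs_def)

text \<open>
  The \<open>z\<close> part of the stationarity condition is that of the fixed constraints: a free multiplier of
  a fixed equation is split into its positive and negative part, which become the multipliers of the
  two inequalities (both active) that replace the equation; the balance equations get multiplier
  zero. This creates a residue in the \<open>u\<close> part, one multiple of a coordinate vector per line. The
  binary constraint of a line has gradient \<open>2 u - 1 = \<plusminus>1\<close> times that coordinate vector, and its
  unrestricted multiplier absorbs the residue.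
\<close>

lemma dnr_kkt_if_fixed_kkt:
  fixes N :: "('n::finite, 'l::finite) network"
  assumes feas: "(z, u) \<in> dnr_feasible N d" and T: "T = {e. u $ e = 1}"
    and kkt: "kkt (line_loss N) (fix_eqs T) (fix_eq N) (fix_ineqs T) (fix_ineq N) z lam mu"
  shows "\<exists>lam' mu'. kkt (dnr_obj N) UNIV (dnr_eq N d) UNIV (dnr_ineq N) (z, u) lam' mu'"
proof -
  define mu' where "mu' k = (case k of
      DropLo e \<Rightarrow> if e \<in> T then max 0 (- lam (FDrop e)) else 0
    | DropUp e \<Rightarrow> if e \<in> T then max 0 (lam (FDrop e)) else 0
    | PLo e \<Rightarrow> if e \<in> T then mu (FPLo e) else max 0 (- lam (FPOff e))
    | PUp e \<Rightarrow> if e \<in> T then mu (FPUp e) else max 0 (lam (FPOff e))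
    | QLo e \<Rightarrow> if e \<in> T then mu (FQLo e) else max 0 (- lam (FQOff e))
    | QUp e \<Rightarrow> if e \<in> T then mu (FQUp e) else max 0 (lam (FQOff e))
    | VLo i \<Rightarrow> mu (FVLo i) | VUp i \<Rightarrow> mu (FVUp i) | Degree j \<Rightarrow> 0)"
    for k :: "('n, 'l) dnr_ineq_idx"
  \<comment> \<open>The coefficient of the coordinate vector of \<open>e\<close> contributed by the inequalities to the
    \<open>u\<close> part.\<close>
  define s where "s e = bigM N * (mu' (DropLo e) + mu' (DropUp e)) -
    Pmax N e * (mu' (PLo e) + mu' (PUp e)) - Qmax N e * (mu' (QLo e) + mu' (QUp e))" for e
  \<comment> \<open>The factor \<open>1 - 2 u\<close> is minus the inverse of \<open>2 u - 1\<close>, as \<open>u\<close> is binary.\<close>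
  define lam' where "lam' c = (case c of
      PBal j \<Rightarrow> 0 | QBal j \<Rightarrow> 0 | Flow e \<Rightarrow> lam (FFlow e)
    | Binary e \<Rightarrow> (1 - 2 * u $ e) * s e | LineCount \<Rightarrow> 0)"
    for c :: "('n, 'l) dnr_eq_idx"
  note bin = dnr_feasible_binary[OF feas]
  have eq: "dnr_eq N d c (z, u) = 0" and ineq: "dnr_ineq N k (z, u) \<le> 0" for c k
    using feas by (auto simp: dnr_feasible_def feasible_set_def)
  have fix_eq: "fix_eq N c z = 0" if "c \<in> fix_eqs T" for c
    using kkt that by (auto simp: kkt_def)
  have mu_nonneg: "0 \<le> mu k" if "k \<in> fix_ineqs T" for k
    using kkt that by (auto simp: kkt_def)
  have "0 \<le> - (mu k * fix_ineq N k z)" if "k \<in> fix_ineqs T" for k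
    using kkt that by (auto simp: kkt_def mult_nonneg_nonpos)
  moreover have "(\<Sum>k\<in>fix_ineqs T. - (mu k * fix_ineq N k z)) = 0"
    using kkt by (simp add: kkt_def sum_negf)
  ultimately have "\<forall>k\<in>fix_ineqs T. - (mu k * fix_ineq N k z) = 0"
    by (subst (asm) sum_nonneg_eq_0_iff[OF finite_fix_idx(2)])
  then have compl: "mu k * fix_ineq N k z = 0" if "k \<in> fix_ineqs T" for k
    using that by simp

  have mu'_nonneg: "0 \<le> mu' k" for k
    by (cases k) (auto simp: mu'_def fix_ineqs_def intro: mu_nonneg)
  have compl': "mu' k * dnr_ineq N k (z, u) = 0" for k
  proof (cases k)
    case (DropLo e)
    then show ?thesis
      using fix_eq[of "FDrop e"] by (auto simp: mu'_def T fix_eqs_def)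
  next
    case (DropUp e)
    then show ?thesis
      using fix_eq[of "FDrop e"] by (auto simp: mu'_def T fix_eqs_def)
  next
    case (PLo e)
    then show ?thesis
      using bin[of e] fix_eq[of "FPOff e"] compl[of "FPLo e"]
      by (auto simp: mu'_def T fix_eqs_def fix_ineqs_def)
  next
    case (PUp e)
    then show ?thesis
      using bin[of e] fix_eq[of "FPOff e"] compl[of "FPUp e"]
      by (auto simp: mu'_def T fix_eqs_def fix_ineqs_def)
  next
    case (QLo e)
    then show ?thesis
      using bin[of e] fix_eq[of "FQOff e"] compl[of "FQLo e"]
      by (auto simp: mu'_def T fix_eqs_def fix_ineqs_def)
  next
    case (QUp e)
    then show ?thesis
      using bin[of e] fix_eq[of "FQOff e"] compl[of "FQUp e"]
      by (auto simp: mu'_def T fix_eqs_def fix_ineqs_def)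
  next
    case (VLo i)
    then show ?thesis using compl[of "FVLo i"] by (simp add: mu'_def fix_ineqs_def)
  next
    case (VUp i)
    then show ?thesis using compl[of "FVUp i"] by (simp add: mu'_def fix_ineqs_def)
  next
    case (Degree j)
    then show ?thesis by (simp add: mu'_def)
  qed

  define X where "X = (\<Sum>c\<in>UNIV. lam' c *\<^sub>R gradient (dnr_eq N d c) (z, u)) +
      (\<Sum>k\<in>UNIV. mu' k *\<^sub>R gradient (dnr_ineq N k) (z, u))"
  have to_UNIV: "(\<Sum>e\<in>S. c e *\<^sub>R Y e) = (\<Sum>e\<in>UNIV. (if e \<in> S then c e else 0) *\<^sub>R Y e)"
    for S :: "'l set" and c :: "'l \<Rightarrow> real" and Y :: "'l \<Rightarrow> ('n, 'l) zvar"
    by (rule sum.mono_neutral_cong_left) auto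
  let ?g = "\<lambda>c. gradient (fix_eq N c) z" and ?h = "\<lambda>k. gradient (fix_ineq N k) z"

  have D: "(\<Sum>e\<in>UNIV. mu' (DropLo e) *\<^sub>R - ?g (FDrop e)) + (\<Sum>e\<in>UNIV. mu' (DropUp e) *\<^sub>R ?g (FDrop e)) =
      (\<Sum>e\<in>T. lam (FDrop e) *\<^sub>R ?g (FDrop e))"
    unfolding to_UNIV[of _ _ T] sum.distrib[symmetric]
    by (rule sum.cong) (auto simp: mu'_def max_def)
  have P: "(\<Sum>e\<in>UNIV. mu' (PLo e) *\<^sub>R - ?g (FPOff e)) + (\<Sum>e\<in>UNIV. mu' (PUp e) *\<^sub>R ?g (FPOff e)) =
      (\<Sum>e\<in>-T. lam (FPOff e) *\<^sub>R ?g (FPOff e)) +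
      ((\<Sum>e\<in>T. mu (FPLo e) *\<^sub>R - ?g (FPOff e)) + (\<Sum>e\<in>T. mu (FPUp e) *\<^sub>R ?g (FPOff e)))"
    unfolding to_UNIV[of _ _ T] to_UNIV[of _ _ "-T"] sum.distrib[symmetric]
    by (rule sum.cong) (auto simp: mu'_def max_def)
  have Q: "(\<Sum>e\<in>UNIV. mu' (QLo e) *\<^sub>R - ?g (FQOff e)) + (\<Sum>e\<in>UNIV. mu' (QUp e) *\<^sub>R ?g (FQOff e)) =
      (\<Sum>e\<in>-T. lam (FQOff e) *\<^sub>R ?g (FQOff e)) +
      ((\<Sum>e\<in>T. mu (FQLo e) *\<^sub>R - ?g (FQOff e)) + (\<Sum>e\<in>T. mu (FQUp e) *\<^sub>R ?g (FQOff e)))"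
    unfolding to_UNIV[of _ _ T] to_UNIV[of _ _ "-T"] sum.distrib[symmetric]
    by (rule sum.cong) (auto simp: mu'_def max_def)
  have "fst X = (\<Sum>e\<in>UNIV. lam (FFlow e) *\<^sub>R ?g (FFlow e)) +
      ((\<Sum>e\<in>UNIV. mu' (DropLo e) *\<^sub>R - ?g (FDrop e)) + (\<Sum>e\<in>UNIV. mu' (DropUp e) *\<^sub>R ?g (FDrop e))) +
      ((\<Sum>e\<in>UNIV. mu' (PLo e) *\<^sub>R - ?g (FPOff e)) + (\<Sum>e\<in>UNIV. mu' (PUp e) *\<^sub>R ?g (FPOff e))) +
      ((\<Sum>e\<in>UNIV. mu' (QLo e) *\<^sub>R - ?g (FQOff e)) + (\<Sum>e\<in>UNIV. mu' (QUp e) *\<^sub>R ?g (FQOff e))) +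
      (\<Sum>i\<in>UNIV. mu (FVLo i) *\<^sub>R ?h (FVLo i)) + (\<Sum>i\<in>UNIV. mu (FVUp i) *\<^sub>R ?h (FVUp i))"
    unfolding X_def sum_dnr_eq_idx sum_dnr_ineq_idx gradient_dnr_eq gradient_dnr_ineq fst_add fst_sum fst_scaleR
    by (simp add: lam'_def mu'_def[of "VLo _"] mu'_def[of "VUp _"] mu'_def[of "Degree _"] add.assoc
        del: scaleR_minus_right)
  also have "\<dots> = (\<Sum>c\<in>fix_eqs T. lam c *\<^sub>R ?g c) + (\<Sum>k\<in>fix_ineqs T. mu k *\<^sub>R ?h k)"
    unfolding D P Q sum_fix_eqs sum_fix_ineqs gradient_fix_ineq by (simp only: ac_simps)
  also have "\<dots> = - gradient (line_loss N) z"
    using kkt by (simp add: kkt_def)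
  finally have fst_X: "fst X = - gradient (line_loss N) z" .

  have "snd X = (\<Sum>e\<in>UNIV. lam' (Binary e) *\<^sub>R ((2 * u $ e - 1) *\<^sub>R axis e 1)) +
      (\<Sum>e\<in>UNIV. mu' (DropLo e) *\<^sub>R (bigM N *\<^sub>R axis e 1)) +
      (\<Sum>e\<in>UNIV. mu' (DropUp e) *\<^sub>R (bigM N *\<^sub>R axis e 1)) +
      (\<Sum>e\<in>UNIV. mu' (PLo e) *\<^sub>R (- Pmax N e *\<^sub>R axis e 1)) +
      (\<Sum>e\<in>UNIV. mu' (PUp e) *\<^sub>R (- Pmax N e *\<^sub>R axis e 1)) +
      (\<Sum>e\<in>UNIV. mu' (QLo e) *\<^sub>R (- Qmax N e *\<^sub>R axis e 1)) +
      (\<Sum>e\<in>UNIV. mu' (QUp e) *\<^sub>R (- Qmax N e *\<^sub>R axis e 1))"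
    unfolding X_def sum_dnr_eq_idx sum_dnr_ineq_idx gradient_dnr_eq gradient_dnr_ineq snd_add snd_sum snd_scaleR
    by (simp add: lam'_def[of "PBal _"] lam'_def[of "QBal _"] lam'_def[of LineCount]
        mu'_def[of "Degree _"] add.assoc del: scaleR_scaleR scaleR_minus_left)
  also have "\<dots> = (\<Sum>e\<in>UNIV. (lam' (Binary e) * (2 * u $ e - 1) + s e) *\<^sub>R axis e 1)"
    unfolding sum.distrib[symmetric] scaleR_scaleR scaleR_add_left[symmetric]
    by (simp add: s_def algebra_simps)
  also have "\<dots> = 0"
  proof (intro sum.neutral ballI)
    fix e
    show "(lam' (Binary e) * (2 * u $ e - 1) + s e) *\<^sub>R axis e (1 :: real) = 0"
      using bin[of e] by (auto simp: lam'_def)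
  qed
  finally have "X = - gradient (dnr_obj N) (z, u)"
    using fst_X by (simp add: gradient_dnr_obj prod_eq_iff)
  then have "kkt (dnr_obj N) UNIV (dnr_eq N d) UNIV (dnr_ineq N) (z, u) lam' mu'"
    using eq ineq mu'_nonneg compl' by (simp add: kkt_def X_def sum.neutral del: mult_eq_0_iff)
  then show ?thesis by blast
qed

section \<open>KKT conditions at the locally optimal solutions\<close>

theorem proposition1:
  fixes N :: "('n::finite, 'l::finite) network"
    and D :: "'n load set"
  assumes "open D" and "D \<noteq> {}"
    and "bigM_sufficient N D"
    and "radiality_ensured N D"
    and "\<forall>T\<in>spanning_trees N. \<forall>z\<in>Z_set N T.
           licq (fix_eqs T) (fix_eq N) (fix_ineqs T) (fix_ineq N) z"
  shows "AE d in lebesgue_on D.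
           \<forall>z u. locally_optimal (dnr_obj N) (dnr_feasible N d) (z, u) \<longrightarrow>
             (\<exists>lam mu. kkt (dnr_obj N) UNIV (dnr_eq N d) UNIV (dnr_ineq N) (z, u) lam mu)"
proof (rule AE_I2, intro allI impI)
  fix d z u
  assume "d \<in> space (lebesgue_on D)"
    and opt: "locally_optimal (dnr_obj N) (dnr_feasible N d) (z, u)"
  then have d: "d \<in> D" by simp
  have feas: "(z, u) \<in> dnr_feasible N d"
    using opt by (simp add: locally_optimal_def)
  let ?T = "{e. u $ e = 1}"
  have "?T \<in> spanning_trees N"
    using assms(4) d feas unfolding radiality_ensured_def by blast
  then have licq: "licq (fix_eqs ?T) (fix_eq N) (fix_ineqs ?T) (fix_ineq N) z"
    using assms(5) dnr_feasible_imp_Z_set[OF feas] by blast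
  have "continuous_on UNIV (fix_eq N c)" "continuous_on UNIV (fix_ineq N k)" for c k
    by (rule continuous_at_imp_continuous_on, intro ballI differentiable_imp_continuous_within
        fix_eq_differentiable fix_ineq_differentiable)+
  then have "\<exists>lam mu. kkt (line_loss N) (fix_eqs ?T) (fix_eq N) (fix_ineqs ?T) (fix_ineq N) z lam mu"
    using dnr_locally_optimal_imp_line_loss_locally_optimal[OF assms(3) d opt] licq
    by (intro locally_optimal_licq_imp_kkt[where U = UNIV])
      (auto simp: Z_set_def finite_fix_idx line_loss_differentiable fix_eq_differentiable
        fix_ineq_differentiable)
  then show "\<exists>lam mu. kkt (dnr_obj N) UNIV (dnr_eq N d) UNIV (dnr_ineq N) (z, u) lam mu"
    using dnr_kkt_if_fixed_kkt[OF feas refl] by blast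
qed

end
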